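(* Let $A \in \mathbb{R}^{m \times n}$ be a real matrix all of whose rows are nonzero and all of whose columns satisfy $\|A^j\| = 1$, $j = 1,\dots,n$, let $\hat b \in \mathbb{R}^m$, and let $\alpha, \omega \in (0,2)$. Then, for any starting vector $x^0 \in \mathbb{R}^n$, every sequence $(x^k)_{k \in \mathbb{N}}$ generated by the Maximal Residual Extended Kaczmarz (MREK) algorithm with parameters $\alpha,\omega$ converges to a least-squares solution, i.e. to an element of $LSS(A;\hat b)$.
   Context: Notation: $[q]=\{1,\dots,q\}$; $\langle\cdot,\cdot\rangle$ is the Euclidean inner product and $\|\cdot\|$ the Euclidean norm; $A_i$ denotes the $i$-th row of $A$ (as a vector in $\mathbb{R}^n$) and $A^j$ the $j$-th column of $A$ (a vector in $\mathbb{R}^m$); $\hat b^k_i$ denotes the $i$-th component of the vector $\hat b^k$. $\mathcal{R}(A)$ and $\mathcal{N}(A)$ are the range and null space of $A$, and $P_{\mathcal{R}(A)}$ is the orthogonal projector onto $\mathcal{R}(A)$. Least-squares solution set: $LSS(A;\hat b) = \{x \in \mathbb{R}^n : Ax = P_{\mathcal{R}(A)}(\hat b)\}$, equivalently the set of minimizers of $\|Ax-\hat b\|$. The system $Ax=\hat b$ may be inconsistent. MREK algorithm: start with an arbitrary $x^0 \in \mathbb{R}^n$ and $y^0 = \hat b$. For $k = 1, 2, 3, \dots$ (run indefinitely): 1. select an index $j_k \in [n]$ such that $|\langle A^{j_k}, y^{k-1}\rangle| \ge |\langle A^{j}, y^{k-1}\rangle|$ for all $j \in [n]$ (ties broken arbitrarily),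 and set $y^k = y^{k-1} - \alpha \langle y^{k-1}, A^{j_k}\rangle A^{j_k}$; 2. set $\hat b^k = \hat b - y^k$; 3. select an index $i_k \in [m]$ such that $|\langle A_{i_k}, x^{k-1}\rangle - \hat b^k_{i_k}| \ge |\langle A_i, x^{k-1}\rangle - \hat b^k_i|$ for all $i \in [m]$ (ties broken arbitrarily), and set $$x^k = x^{k-1} - \omega\, \frac{\langle x^{k-1}, A_{i_k}\rangle - \hat b^k_{i_k}}{\|A_{i_k}\|^2}\, A_{i_k}.$$ *)

theory Defs
  imports "HOL-Analysis.Analysis"
begin

definition orthogonal_projector :: "'a::euclidean_space set \<Rightarrow> 'a \<Rightarrow> 'a" where
  "orthogonal_projector S b = (THE p. p \<in> S \<and> b - p \<in> orthogonal_comp S)"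

text \<open>The description is well defined whenever \<open>S\<close> is a linear subspace, which is the only case of interest.\<close>

lemma orthogonal_projector_ex1:
  fixes S :: "'a::euclidean_space set"
  assumes "subspace S"
  shows "\<exists>!p. p \<in> S \<and> b - p \<in> orthogonal_comp S"
proof -
  obtain y z where y: "y \<in> span S" and z: "\<And>w. w \<in> span S \<Longrightarrow> orthogonal z w" and b: "b = y + z"
    using orthogonal_subspace_decomp_exists[of S b] by blast
  have sp: "span S = S" using assms by (simp add: span_eq_iff)
  show ?thesis
  proof (rule ex1I[of _ y])
    show "y \<in> S \<and> b - y \<in> orthogonal_comp S"
      using y z b sp by (auto simp: orthogonal_comp_def orthogonal_commute)
  next
    fix p assume p: "p \<in> S \<and> b - p \<in> orthogonal_comp S"
    have "p - y \<in> S" using p y sp assms subspace_diff by metis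
    have "(p - y) \<bullet> (b - p) = 0"
      using p \<open>p - y \<in> S\<close> unfolding orthogonal_comp_def orthogonal_def by blast
    moreover have "(p - y) \<bullet> z = 0"
      using z[of "p - y"] \<open>p - y \<in> S\<close> sp by (metis inner_commute orthogonal_def)
    ultimately have "(p - y) \<bullet> (p - y) = 0" using b by (simp add: algebra_simps inner_simps)
    then show "p = y" by simp
  qed
qed

definition LSS :: "real^'n^'m \<Rightarrow> real^'m \<Rightarrow> (real^'n) set" where
  "LSS A b = {x. A *v x = orthogonal_projector (range ((*v) A)) b}"

text \<open>The algorithm is nondeterministic (ties are broken arbitrarily), so it is rendered as a relation:
  \<open>x\<close> is one of the sequences that some choice of the indices can generate. Iteration \<open>k \<ge> 1\<close> is
  written with \<open>Suc k\<close>; \<open>bh\<close> is the sequence of corrected right-hand sides, whose value at \<open>0\<close>,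
  like those of the selected indices \<open>j\<close> and \<open>i\<close>, is irrelevant.\<close>

definition MREK_sequence ::
  "real^'n^'m \<Rightarrow> real^'m \<Rightarrow> real \<Rightarrow> real \<Rightarrow> real^'n \<Rightarrow> (nat \<Rightarrow> real^'n) \<Rightarrow> bool" where
  "MREK_sequence A b \<alpha> \<omega> x0 x \<longleftrightarrow>
    (\<exists>(y :: nat \<Rightarrow> real^'m) (bh :: nat \<Rightarrow> real^'m) (j :: nat \<Rightarrow> 'n) (i :: nat \<Rightarrow> 'm).
      x 0 = x0 \<and> y 0 = b \<and>
      (\<forall>k.
        (\<forall>l. \<bar>column (j (Suc k)) A \<bullet> y k\<bar> \<ge> \<bar>column l A \<bullet> y k\<bar>) \<and>
        y (Suc k) = y k - (\<alpha> * (y k \<bullet> column (j (Suc k)) A)) *\<^sub>R column (j (Suc k)) A \<and>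
        bh (Suc k) = b - y (Suc k) \<and>
        (\<forall>l. \<bar>row (i (Suc k)) A \<bullet> x k - bh (Suc k) $ i (Suc k)\<bar> \<ge> \<bar>row l A \<bullet> x k - bh (Suc k) $ l\<bar>) \<and>
        x (Suc k) = x k - (\<omega> * ((x k \<bullet> row (i (Suc k)) A - bh (Suc k) $ i (Suc k))
                                 / (norm (row (i (Suc k)) A))\<^sup>2)) *\<^sub>R row (i (Suc k)) A))"

end

theory Submission
  imports Defs
begin

text \<open>Subtracting the limits turns both halves of the algorithm into the same greedy relaxed Kaczmarz
  step, applied to a vector in the span of the projection directions and with a perturbed residual.
  Such a step contracts the norm by a fixed factor \<open>\<delta> < 1\<close> up to a multiple of the perturbation.
  For \<open>y\<close> (directions: columns) there is no perturbation, so \<open>y\<close> converges to the residual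
  \<open>b - P b\<close>; for \<open>x\<close> (directions: rows) the perturbation is the error of \<open>y\<close>, which tends to zero.\<close>

text \<open>A vector of the span orthogonal to every \<open>v l\<close> is orthogonal to itself, so
  \<open>z \<mapsto> (v l \<bullet> z)\<close> over all \<open>l\<close> is injective on the span,
  hence bounded below there. The greedy choice needs this for a single \<open>l\<close>: it makes
  the largest residual comparable to \<open>norm z\<close>.\<close>

lemma coercive_on_span:
  fixes v :: "'i::finite \<Rightarrow> 'a::euclidean_space"
  shows "\<exists>c>0. \<forall>z\<in>span (range v). \<exists>l. c * norm z \<le> \<bar>v l \<bullet> z\<bar>"
proof -
  define f where "f = (\<lambda>z. (\<chi> l. v l \<bullet> z) :: real^'i)"
  have lin: "bounded_linear f"
    unfolding f_def by (intro linear_conv_bounded_linear[THEN iffD1] linearI)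
      (simp_all add: vec_eq_iff inner_simps)
  have inj: "z = 0" if "z \<in> span (range v)" "f z = 0" for z
  proof -
    have "orthogonal z w" if "w \<in> range v" for w
      using that \<open>f z = 0\<close> by (auto simp: f_def vec_eq_iff orthogonal_def inner_commute)
    then have "orthogonal z z" using that(1) orthogonal_to_span by blast
    then show ?thesis by (simp add: orthogonal_self)
  qed
  obtain e where e: "e > 0" "\<And>z. z \<in> span (range v) \<Longrightarrow> e * norm z \<le> norm (f z)"
    using injective_imp_isometric[OF closed_span subspace_span lin, of "range v"] inj by blast
  define N where "N = real CARD('i)"
  have N: "N > 0" by (simp add: N_def)
  \<comment> \<open>If all \<open>N\<close> entries of \<open>f z\<close> were below
    \<open>e / N * norm z\<close>, their absolute sum would be below \<open>e * norm z\<close>,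
    although it dominates the Euclidean norm of \<open>f z\<close>.\<close>
  have "\<exists>l. e / N * norm z \<le> \<bar>v l \<bullet> z\<bar>" if z: "z \<in> span (range v)" for z
  proof (rule ccontr)
    assume "\<not> ?thesis"
    then have "\<bar>v l \<bullet> z\<bar> < e / N * norm z" for l by (simp add: not_le)
    then have "(\<Sum>l\<in>UNIV. \<bar>f z $ l\<bar>) < (\<Sum>l\<in>(UNIV::'i set). e / N * norm z)"
      by (intro sum_strict_mono) (simp_all add: f_def)
    also have "\<dots> = e * norm z" using N by (simp add: N_def)
    also have "\<dots> \<le> norm (f z)" using e z by blast
    also have "\<dots> \<le> (\<Sum>l\<in>UNIV. \<bar>f z $ l\<bar>)" by (rule norm_le_l1_cart)
    finally show False by simp
  qed
  with e(1) N show ?thesis by (intro exI[of _ "e / N"]) auto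
qed

text \<open>The range (0,2) of the relaxation parameter enters here: it makes the factor
  \<open>\<omega> * (2 - \<omega>)\<close> positive, so the step never increases the norm.\<close>

lemma relaxed_projection_norm_sq:
  fixes v z :: "'a::real_inner"
  assumes "v \<noteq> 0"
  shows "(norm (z - (\<omega> * ((v \<bullet> z) / (norm v)\<^sup>2)) *\<^sub>R v))\<^sup>2
    = (norm z)\<^sup>2 - \<omega> * (2 - \<omega>) * ((v \<bullet> z)\<^sup>2 / (norm v)\<^sup>2)"
proof -
  define a where "a = \<omega> * ((v \<bullet> z) / (norm v)\<^sup>2)"
  have "(norm (z - a *\<^sub>R v))\<^sup>2 = (norm z)\<^sup>2 - 2 * a * (v \<bullet> z) + a\<^sup>2 * (norm v)\<^sup>2"
    unfolding power2_norm_eq_inner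
    by (simp add: inner_diff_left inner_diff_right inner_commute power2_eq_square)
  also have "\<dots> = (norm z)\<^sup>2 - \<omega> * (2 - \<omega>) * ((v \<bullet> z)\<^sup>2 / (norm v)\<^sup>2)"
    using assms by (simp add: a_def power2_eq_square field_simps)
  finally show ?thesis unfolding a_def .
qed

text \<open>Either the perturbation is small against \<open>norm z\<close>, and the greedy index
  still sees a fixed fraction of \<open>norm z\<close>, or \<open>norm z\<close> is itself bounded
  by a multiple of \<open>\<epsilon>\<close>. The constants depend on \<open>v\<close> and
  \<open>\<omega>\<close> only, which is what allows the step to be iterated.\<close>

lemma greedy_kaczmarz_step:
  fixes v :: "'i::finite \<Rightarrow> 'a::euclidean_space"
  assumes nz: "\<And>i. v i \<noteq> 0" and \<omega>: "0 < \<omega>" "\<omega> < 2"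
  shows "\<exists>\<delta> C. 0 \<le> \<delta> \<and> \<delta> < 1 \<and> (\<forall>z\<in>span (range v). \<forall>d \<epsilon> i.
    (\<forall>l. \<bar>d l\<bar> \<le> \<epsilon>) \<longrightarrow> (\<forall>l. \<bar>v l \<bullet> z + d l\<bar> \<le> \<bar>v i \<bullet> z + d i\<bar>) \<longrightarrow>
    norm (z - (\<omega> * ((v i \<bullet> z + d i) / (norm (v i))\<^sup>2)) *\<^sub>R v i) \<le> \<delta> * norm z + C * \<epsilon>)"
proof -
  obtain c where c: "c > 0" "\<And>z. z \<in> span (range v) \<Longrightarrow> \<exists>l. c * norm z \<le> \<bar>v l \<bullet> z\<bar>"
    using coercive_on_span[of v] by blast
  \<comment> \<open>One constant that bounds all norms \<open>norm (v i)\<close> and all their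
    reciprocals.\<close>
  define M where "M = (\<Sum>i\<in>UNIV. norm (v i) + 1 / norm (v i))"
  have Mi: "norm (v i) + 1 / norm (v i) \<le> M" for i
    unfolding M_def by (rule member_le_sum) auto
  have M1: "norm (v i) \<le> M" and M2: "1 / norm (v i) \<le> M" for i
  proof -
    have "0 \<le> norm (v i)" "0 \<le> 1 / norm (v i)" by simp_all
    with Mi[of i] show "norm (v i) \<le> M" "1 / norm (v i) \<le> M" by linarith+
  qed
  have M: "M > 0" using M1 nz by (metis less_le_trans zero_less_norm_iff)
  \<comment> \<open>The relative decrease of the squared norm when
    \<open>\<bar>v i \<bullet> z\<bar>\<close> is at least \<open>c * norm z / 2\<close>.\<close>
  define \<kappa> where "\<kappa> = \<omega> * (2 - \<omega>) * (c / (2 * M))\<^sup>2"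
  have \<kappa>: "\<kappa> > 0" using \<omega> c M by (simp add: \<kappa>_def)
  define \<delta> where "\<delta> = sqrt (max 0 (1 - \<kappa>))"
  \<comment> \<open>The term \<open>4 / c\<close> serves the case of a dominating perturbation,
    \<open>\<omega> * M\<close> the displacement caused by \<open>d i\<close>.\<close>
  define C where "C = 4 / c + \<omega> * M"
  have \<delta>: "0 \<le> \<delta>" "\<delta> < 1" "1 - \<kappa> \<le> \<delta>\<^sup>2" using \<kappa> by (simp_all add: \<delta>_def)
  show ?thesis
  proof (rule exI[of _ \<delta>], rule exI[of _ C], intro conjI \<delta>(1,2) ballI allI impI)
    fix z d \<epsilon> i
    assume z: "z \<in> span (range v)" and "\<forall>l. \<bar>d l\<bar> \<le> \<epsilon>"
      and "\<forall>l. \<bar>v l \<bullet> z + d l\<bar> \<le> \<bar>v i \<bullet> z + d i\<bar>"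
    then have d: "\<bar>d l\<bar> \<le> \<epsilon>" and mx: "\<bar>v l \<bullet> z + d l\<bar> \<le> \<bar>v i \<bullet> z + d i\<bar>" for l
      by blast+
    define t where "t = v i \<bullet> z"
    \<comment> \<open>The exact step in direction \<open>v i\<close>, although \<open>i\<close> was
      selected by perturbed residuals.\<close>
    define z' where "z' = z - (\<omega> * (t / (norm (v i))\<^sup>2)) *\<^sub>R v i"
    have ni: "norm (v i) > 0" using nz by simp
    have \<epsilon>: "\<epsilon> \<ge> 0" using d[of i] by linarith
    obtain l where l: "c * norm z \<le> \<bar>v l \<bullet> z\<bar>" using c z by blast
    \<comment> \<open>Passing between exact and perturbed residuals costs \<open>\<epsilon>\<close>
      at \<open>l\<close> and again at \<open>i\<close>.\<close>
    have t: "c * norm z - 2 * \<epsilon> \<le> \<bar>t\<bar>" using l mx[of l] d[of l] d[of i] unfolding t_def by linarith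
    have sq: "(norm z')\<^sup>2 = (norm z)\<^sup>2 - \<omega> * (2 - \<omega>) * (t\<^sup>2 / (norm (v i))\<^sup>2)"
      unfolding z'_def t_def by (rule relaxed_projection_norm_sq[OF nz])
    have z': "norm z' \<le> \<delta> * norm z + 4 / c * \<epsilon>"
    \<comment> \<open>The threshold makes the loss \<open>2 * \<epsilon>\<close> at most half of
      \<open>c * norm z\<close>. Beyond it, \<open>norm z\<close> is below
      \<open>4 / c * \<epsilon>\<close> and monotonicity of the exact step suffices.\<close>
    proof (cases "4 * \<epsilon> \<le> c * norm z")
      case True
      have "c * norm z / 2 / M \<le> \<bar>t\<bar> / norm (v i)"
        using t True M1[of i] ni M c by (intro frac_le) auto
      then have "(c * norm z / 2 / M)\<^sup>2 \<le> (\<bar>t\<bar> / norm (v i))\<^sup>2"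
        using c M by (intro power_mono) auto
      then have "(c / (2 * M))\<^sup>2 * (norm z)\<^sup>2 \<le> t\<^sup>2 / (norm (v i))\<^sup>2"
        by (simp add: power_divide power_mult_distrib)
      then have "\<omega> * (2 - \<omega>) * ((c / (2 * M))\<^sup>2 * (norm z)\<^sup>2)
          \<le> \<omega> * (2 - \<omega>) * (t\<^sup>2 / (norm (v i))\<^sup>2)"
        using \<omega> by (intro mult_left_mono) auto
      then have "(norm z')\<^sup>2 \<le> (1 - \<kappa>) * (norm z)\<^sup>2"
        unfolding sq \<kappa>_def by (simp add: algebra_simps)
      also have "\<dots> \<le> \<delta>\<^sup>2 * (norm z)\<^sup>2" using \<delta>(3) by (intro mult_right_mono) auto
      also have "\<dots> = (\<delta> * norm z)\<^sup>2" by (simp add: power_mult_distrib)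
      finally have "norm z' \<le> \<delta> * norm z"
        by (rule power2_le_imp_le) (simp add: \<delta>(1))
      moreover have "0 \<le> 4 / c * \<epsilon>" using \<epsilon> c(1) by simp
      ultimately show ?thesis by linarith
    next
      case False
      have "(norm z')\<^sup>2 \<le> (norm z)\<^sup>2" unfolding sq using \<omega> by simp
      then have "norm z' \<le> norm z" by (rule power2_le_imp_le) simp
      also have "\<dots> \<le> 4 / c * \<epsilon>" using False c(1) by (simp add: field_simps)
      finally have "norm z' \<le> 4 / c * \<epsilon>" .
      moreover have "0 \<le> \<delta> * norm z" using \<delta>(1) by simp
      ultimately show ?thesis by linarith
    qed
    have "z - (\<omega> * ((v i \<bullet> z + d i) / (norm (v i))\<^sup>2)) *\<^sub>R v i
        = z' - (\<omega> * (d i / (norm (v i))\<^sup>2)) *\<^sub>R v i"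
      by (simp add: z'_def t_def add_divide_distrib distrib_left scaleR_add_left)
    also have "norm \<dots> \<le> norm z' + norm ((\<omega> * (d i / (norm (v i))\<^sup>2)) *\<^sub>R v i)"
      by (rule norm_triangle_ineq4)
    also have "norm ((\<omega> * (d i / (norm (v i))\<^sup>2)) *\<^sub>R v i) = \<omega> * (\<bar>d i\<bar> * (1 / norm (v i)))"
      using ni \<omega> by (simp add: abs_mult power2_eq_square)
    also have "\<dots> \<le> \<omega> * (\<epsilon> * M)"
      using \<omega> d[of i] M2[of i] \<epsilon> by (intro mult_left_mono mult_mono) auto
    finally show "norm (z - (\<omega> * ((v i \<bullet> z + d i) / (norm (v i))\<^sup>2)) *\<^sub>R v i) \<le> \<delta> * norm z + C * \<epsilon>"
      using z' by (simp add: C_def algebra_simps)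
  qed
qed

lemma perturbed_contraction_tendsto_0:
  fixes a u :: "nat \<Rightarrow> real"
  assumes a0: "\<And>k. 0 \<le> a k" and \<delta>: "0 \<le> \<delta>" "\<delta> < 1"
    and step: "\<And>k. a (Suc k) \<le> \<delta> * a k + u k" and u: "u \<longlonglongrightarrow> 0"
  shows "a \<longlonglongrightarrow> 0"
proof (rule LIMSEQ_I)
  fix r :: real assume r: "r > 0"
  \<comment> \<open>Chosen so that \<open>r / 2\<close> is the fixed point of
    \<open>s \<mapsto> \<delta> * s + \<eta>\<close>; the induction for \<open>bd\<close> reproduces
    it exactly.\<close>
  define \<eta> where "\<eta> = (1 - \<delta>) * (r / 2)"
  have "\<eta> > 0" using r \<delta> by (simp add: \<eta>_def)
  then obtain N where N: "\<And>k. k \<ge> N \<Longrightarrow> \<bar>u k\<bar> < \<eta>"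
    using LIMSEQ_D[OF u, of \<eta>] by auto
  have bd: "a (N + n) \<le> \<delta> ^ n * a N + r / 2" for n
  proof (induction n)
    case 0
    show ?case using r by simp
  next
    case (Suc n)
    have "a (N + Suc n) \<le> \<delta> * a (N + n) + u (N + n)" using step by simp
    also have "\<dots> \<le> \<delta> * (\<delta> ^ n * a N + r / 2) + \<eta>"
      using Suc \<delta> N[of "N + n"] by (intro add_mono mult_left_mono) auto
    also have "\<dots> = \<delta> ^ Suc n * a N + r / 2" by (simp add: \<eta>_def field_simps)
    finally show ?case .
  qed
  have "(\<lambda>n. \<delta> ^ n * a N) \<longlonglongrightarrow> 0 * a N"
    using \<delta> by (intro tendsto_mult_right LIMSEQ_realpow_zero) auto
  then obtain K where K: "\<And>n. n \<ge> K \<Longrightarrow> \<bar>\<delta> ^ n * a N\<bar> < r / 2"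
    using LIMSEQ_D[of "\<lambda>n. \<delta> ^ n * a N" 0 "r / 2"] r by auto
  have "norm (a n - 0) < r" if "n \<ge> N + K" for n
  proof -
    have "a n \<le> \<delta> ^ (n - N) * a N + r / 2" using bd[of "n - N"] that by simp
    moreover have "\<bar>\<delta> ^ (n - N) * a N\<bar> < r / 2" using that by (intro K) simp
    ultimately have "a n < r" by linarith
    with a0[of n] show ?thesis by simp
  qed
  then show "\<exists>no. \<forall>n\<ge>no. norm (a n - 0) < r" by blast
qed

text \<open>Every step moves along some \<open>v i\<close>, so the iterates never leave the span,
  where the uniform contraction is available.\<close>

lemma greedy_kaczmarz_tendsto_0:
  fixes v :: "'i::finite \<Rightarrow> 'a::euclidean_space" and z :: "nat \<Rightarrow> 'a"
  assumes nz: "\<And>i. v i \<noteq> 0" and \<omega>: "0 < \<omega>" "\<omega> < 2"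
    and z0: "z 0 \<in> span (range v)"
    and greedy: "\<And>k l. \<bar>v l \<bullet> z k + d k l\<bar> \<le> \<bar>v (i k) \<bullet> z k + d k (i k)\<bar>"
    and step: "\<And>k. z (Suc k)
      = z k - (\<omega> * ((v (i k) \<bullet> z k + d k (i k)) / (norm (v (i k)))\<^sup>2)) *\<^sub>R v (i k)"
    and d: "\<And>k l. \<bar>d k l\<bar> \<le> \<epsilon> k" and \<epsilon>: "\<epsilon> \<longlonglongrightarrow> 0"
  shows "z \<longlonglongrightarrow> 0"
proof -
  obtain \<delta> C where \<delta>: "0 \<le> \<delta>" "\<delta> < 1" and
    C: "\<forall>z\<in>span (range v). \<forall>d \<epsilon> i.
      (\<forall>l. \<bar>d l\<bar> \<le> \<epsilon>) \<longrightarrow> (\<forall>l. \<bar>v l \<bullet> z + d l\<bar> \<le> \<bar>v i \<bullet> z + d i\<bar>) \<longrightarrow>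
      norm (z - (\<omega> * ((v i \<bullet> z + d i) / (norm (v i))\<^sup>2)) *\<^sub>R v i) \<le> \<delta> * norm z + C * \<epsilon>"
    using greedy_kaczmarz_step[of v \<omega>, OF nz \<omega>] by (elim exE conjE)
  have zk: "z k \<in> span (range v)" for k
    by (induction k) (auto simp: step z0 intro!: span_diff span_scale intro: span_base)
  have "norm (z (Suc k)) \<le> \<delta> * norm (z k) + C * \<epsilon> k" for k
    unfolding step by (intro C[rule_format] zk d greedy)
  moreover have "(\<lambda>k. C * \<epsilon> k) \<longlonglongrightarrow> 0" using tendsto_mult_left[OF \<epsilon>, of C] by simp
  ultimately have "(\<lambda>k. norm (z k)) \<longlonglongrightarrow> 0"
    by (rule perturbed_contraction_tendsto_0[OF norm_ge_zero \<delta>])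
  then show ?thesis by (simp add: tendsto_norm_zero_iff)
qed

theorem theorem4p3:
  fixes A :: "real^'n^'m" and b :: "real^'m" and \<alpha> \<omega> :: real
    and x0 :: "real^'n" and x :: "nat \<Rightarrow> real^'n"
  assumes "\<And>i. row i A \<noteq> 0"
    and "\<And>j. norm (column j A) = 1"
    and "\<alpha> \<in> {0<..<2}" and "\<omega> \<in> {0<..<2}"
    and "MREK_sequence A b \<alpha> \<omega> x0 x"
  shows "\<exists>x'\<in>LSS A b. x \<longlonglongrightarrow> x'"
proof -
  obtain y bh j i where x0: "x 0 = x0" and y0: "y 0 = b"
    and gy: "\<And>k l. \<bar>column l A \<bullet> y k\<bar> \<le> \<bar>column (j (Suc k)) A \<bullet> y k\<bar>"
    and sy: "\<And>k. y (Suc k) = y k - (\<alpha> * (y k \<bullet> column (j (Suc k)) A)) *\<^sub>R column (j (Suc k)) A"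
    and bh: "\<And>k. bh (Suc k) = b - y (Suc k)"
    and gx: "\<And>k l. \<bar>row l A \<bullet> x k - bh (Suc k) $ l\<bar>
      \<le> \<bar>row (i (Suc k)) A \<bullet> x k - bh (Suc k) $ i (Suc k)\<bar>"
    and sx: "\<And>k. x (Suc k) = x k - (\<omega> * ((x k \<bullet> row (i (Suc k)) A - bh (Suc k) $ i (Suc k))
      / (norm (row (i (Suc k)) A))\<^sup>2)) *\<^sub>R row (i (Suc k)) A"
    using assms(5) unfolding MREK_sequence_def by blast
  define p where "p = orthogonal_projector (range ((*v) A)) b"
  have "subspace (range ((*v) A))"
    by (rule linear_subspace_image[OF matrix_vector_mul_linear subspace_UNIV])
  from theI'[OF orthogonal_projector_ex1[OF this, of b]]
  have p: "p \<in> range ((*v) A)" "b - p \<in> orthogonal_comp (range ((*v) A))"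
    by (auto simp: p_def orthogonal_projector_def)
  have col: "column l A \<bullet> (b - p) = 0" for l
  proof -
    have "column l A = A *v axis l 1" by (simp add: matrix_vector_mult_basis)
    then show ?thesis using p(2) by (auto simp: orthogonal_comp_def orthogonal_def)
  qed
  \<comment> \<open>As \<open>b - p\<close> is orthogonal to all columns, \<open>e\<close> has the
    same inner products with them as \<open>y\<close> and obeys the same recursion. It starts at
    \<open>p\<close>, which lies in the column space.\<close>
  define e where "e k = y k - (b - p)" for k
  have coly: "column l A \<bullet> y k = column l A \<bullet> e k" for l k
    using col[of l] by (simp add: e_def inner_diff_right)
  have "e \<longlonglongrightarrow> 0"
  proof (rule greedy_kaczmarz_tendsto_0[where v = "\<lambda>l. column l A" and \<omega> = \<alpha>
        and d = "\<lambda>_ _. 0" and i = "\<lambda>k. j (Suc k)" and \<epsilon> = "\<lambda>_. 0"])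
    show "column l A \<noteq> 0" for l using assms(2)[of l] by auto
    have "range (\<lambda>l. column l A) = columns A" by (auto simp: columns_def)
    then show "e 0 \<in> span (range (\<lambda>l. column l A))"
      using p(1) by (auto simp: e_def y0 intro: matrix_vector_mult_in_columnspace)
    show "e (Suc k) = e k - (\<alpha> * ((column (j (Suc k)) A \<bullet> e k + 0)
        / (norm (column (j (Suc k)) A))\<^sup>2)) *\<^sub>R column (j (Suc k)) A" for k
      using coly[of "j (Suc k)" k] by (simp add: assms(2) e_def sy inner_commute)
  qed (use assms(3) gy coly in auto)
  \<comment> \<open>Shifted by one, because the update of \<open>x k\<close> already uses
    \<open>y (Suc k)\<close>.\<close>
  then have e: "(\<lambda>k. norm (e (Suc k))) \<longlonglongrightarrow> 0"
    by (intro tendsto_norm_zero LIMSEQ_Suc)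
  obtain w where w: "A *v w = p" using p(1) by auto
  \<comment> \<open>The limit depends on the start: the component \<open>q\<close> of
    \<open>x0 - w\<close> orthogonal to all rows is never changed by the iteration. Adding it to
    \<open>w\<close> gives a solution whose difference from \<open>x0\<close> is the vector
    \<open>u\<close> of the row space.\<close>
  obtain u q where u: "u \<in> span (range (\<lambda>l. row l A))"
    and q: "\<And>t. t \<in> span (range (\<lambda>l. row l A)) \<Longrightarrow> orthogonal q t" and uq: "x0 - w = u + q"
    using orthogonal_subspace_decomp_exists[of "range (\<lambda>l. row l A)" "x0 - w"] by blast
  have comp: "(A *v t) $ l = row l A \<bullet> t" for t l
    by (simp add: matrix_vector_mul_component row_def vec_nth_inverse)
  have "row l A \<bullet> q = 0" for l
    using q[OF span_base, of "row l A"] by (simp add: orthogonal_def inner_commute)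
  then have "A *v q = 0" by (simp add: vec_eq_iff comp)
  then have xs: "A *v (w + q) = p" by (simp add: w matrix_vector_right_distrib)
  define z where "z k = x k - (w + q)" for k
  \<comment> \<open>Since \<open>bh (Suc k)\<close> equals \<open>p - e (Suc k)\<close> and
    \<open>w + q\<close> solves the system with right-hand side \<open>p\<close>, the error of
    \<open>y\<close> is exactly the perturbation.\<close>
  have res: "row l A \<bullet> x k - bh (Suc k) $ l = row l A \<bullet> z k + e (Suc k) $ l" for l k
    using comp[of "w + q" l] by (simp add: xs z_def e_def bh inner_diff_right)
  have "z \<longlonglongrightarrow> 0"
  proof (rule greedy_kaczmarz_tendsto_0[where v = "\<lambda>l. row l A" and \<omega> = \<omega>
        and d = "\<lambda>k l. e (Suc k) $ l" and i = "\<lambda>k. i (Suc k)", OF assms(1)])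
    show "z 0 \<in> span (range (\<lambda>l. row l A))"
      using u uq by (simp add: z_def x0 algebra_simps)
    show "z (Suc k) = z k - (\<omega> * ((row (i (Suc k)) A \<bullet> z k + e (Suc k) $ i (Suc k))
        / (norm (row (i (Suc k)) A))\<^sup>2)) *\<^sub>R row (i (Suc k)) A" for k
      unfolding res[symmetric] by (simp add: z_def sx inner_commute)
    show "\<bar>e (Suc k) $ l\<bar> \<le> norm (e (Suc k))" for k l by (rule component_le_norm_cart)
  qed (use assms(4) gx e in \<open>auto simp: res\<close>)
  then have "x \<longlonglongrightarrow> w + q" unfolding z_def by (rule LIM_zero_cancel)
  moreover have "w + q \<in> LSS A b" using xs by (simp add: LSS_def p_def)
  ultimately show ?thesis by blast
qed

end
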